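(* The barycentric subdivision of the boundary complex of a cuboid has a real-rooted $h$-polynomial. That is, for all $d\ge1$ and $0\le\ell\le d$, the polynomial $h(\mathrm{sd}(\mathcal{C}(\partial Q^d_\ell));x)$ is real-rooted, where $Q^d_\ell$ is the $\ell$-th $d$-dimensional cuboid.
   Context: Cuboids: for $d\ge1$ and $0\le \ell\le d$, $Q_0^d$ is the $d$-cube, and for $\ell>0$ the boundary complex $\mathcal{C}(\partial Q^d_\ell)$ of the cuboid $Q^d_\ell$ is (combinatorially) the boundary of the cubical complex obtained by subdividing $[-1,1]^d$ by the $\ell$ hyperplanes $x_1=0,\ldots,x_\ell=0$; i.e. it is the cubical complex obtained by subdividing the boundary complex of $[-1,1]^d$ by these hyperplanes. (Equivalently, the boundary of $Q^d_\ell$ is the boundary of the complex obtained by gluing two copies of $Q^d_{\ell-1}$ along a common $Q^{d-1}_{\ell-1}$.) The boundary complex of a polytope is the polytopal complex of its proper faces (including $\emptyset$). The barycentric subdivision $\mathrm{sd}(\mathcal{C})$ of a polytopal complex $\mathcal{C}$ is the simplicial complex whose $k$-dimensional faces are the sets $\{F_0,\ldots,F_k\}$ of faces of $\mathcal{C}$ with $\emptyset\subsetneq F_0\subsetneq\cdots\subsetneq F_k$ (together with the empty face). For an $(m-1)$-dimensional complex $\mathcal{K}$, $f(\mathcal{K};x)=\sum_{k=-1}^{m-1}f_k(\mathcal{K})x^{k+1}$, where $f_k$ is the number of $k$-dimensional faces ($f_{-1}=1$), and $h(\mathcal{K};x)=(1-x)^m f(\mathcal{K};\frac{x}{1-x})$.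 A real polynomial is real-rooted if it is identically zero or has only real zeros. *)

theory Defs
  imports "HOL-Analysis.Analysis" "HOL-Computational_Algebra.Polynomial"
begin

text \<open>Faces in the sense of \<open>face_of\<close> include the empty face and the polytope itself.\<close>

definition boundary_complex :: "'a::euclidean_space set \<Rightarrow> 'a set set" where
  "boundary_complex P = {F. F face_of P \<and> F \<noteq> P}"

text \<open>
  Subdivision of a polytopal complex by the hyperplane \<open>a \<bullet> x = b\<close>: a face of the complex that
  the hyperplane crosses is replaced by its two closed pieces and its section, all other faces
  persist. For a face lying on one side, the pieces added here besides the face
  itself are among its own faces (possibly the empty one).
\<close>

definition hyperplane_subdivision :: "'a::euclidean_space \<Rightarrow> real \<Rightarrow> 'a set set \<Rightarrow> 'a set set" where
  "hyperplane_subdivision a b C =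
     (\<Union>F\<in>C. {F \<inter> {x. a \<bullet> x \<le> b}, F \<inter> {x. a \<bullet> x = b}, F \<inter> {x. a \<bullet> x \<ge> b}})"

text \<open>
  The boundary complex of the cuboid \<open>Q\<^sup>d\<^sub>l\<close>, realised as the boundary complex of the cube
  \<open>[-1,1]\<^sup>d\<close> subdivided by the hyperplanes \<open>x\<^sub>1 = 0, \<dots>, x\<^sub>l = 0\<close>. The coordinates are indexed by a
  finite type with \<open>d\<close> elements; \<open>ix\<close> numbers them, so that \<open>x\<^sub>i\<close> is \<open>x $ ix i\<close>.
\<close>

primrec cuboid_boundary :: "(nat \<Rightarrow> 'n::finite) \<Rightarrow> nat \<Rightarrow> (real ^ 'n) set set" where
  "cuboid_boundary ix 0 = boundary_complex (cbox (\<chi> i. -1) (\<chi> i. 1))"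
| "cuboid_boundary ix (Suc l) =
     hyperplane_subdivision (axis (ix (Suc l)) 1) 0 (cuboid_boundary ix l)"

text \<open>
  The simplicial complex of finite chains of nonempty faces, as an abstract complex on the
  faces; the empty chain is its empty face.
\<close>

definition barycentric_subdivision :: "'a set set \<Rightarrow> 'a set set set" where
  "barycentric_subdivision C = {K. finite K \<and> subset.chain (C - {{}}) K}"

text \<open>
  For a finite abstract simplicial complex of dimension \<open>m - 1\<close>, the following is \<open>m\<close>. A face of
  dimension \<open>k\<close> has \<open>k + 1\<close> elements, so \<open>num_faces K i\<close> is the face number \<open>f\<^bsub>i-1\<^esub>\<close>.
\<close>

definition dim_plus_one :: "'v set set \<Rightarrow> nat" where
  "dim_plus_one K = Max (card ` K)"

definition num_faces :: "'v set set \<Rightarrow> nat \<Rightarrow> nat" where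
  "num_faces K i = card {s \<in> K. card s = i}"

definition f_poly :: "'v set set \<Rightarrow> real poly" where
  "f_poly K = (\<Sum>i\<le>dim_plus_one K. monom (of_nat (num_faces K i)) i)"

text \<open>
  \<open>h(K;x) = (1-x)\<^sup>m f(K; x/(1-x))\<close> as a polynomial, with denominators cleared
  (see \<open>poly_h_poly\<close>).
\<close>

definition h_poly :: "'v set set \<Rightarrow> real poly" where
  "h_poly K = (\<Sum>i\<le>dim_plus_one K.
     smult (of_nat (num_faces K i)) ([:0, 1:] ^ i * [:1, -1:] ^ (dim_plus_one K - i)))"

lemma poly_h_poly:
  assumes "x \<noteq> 1"
  shows "poly (h_poly K) x = (1 - x) ^ dim_plus_one K * poly (f_poly K) (x / (1 - x))"
proof -
  have "x ^ i * (1 - x) ^ (m - i) = (1 - x) ^ m * (x / (1 - x)) ^ i" if "i \<le> m" for i m :: nat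
    using that assms by (simp add: power_diff power_divide)
  then show ?thesis
    by (simp add: h_poly_def f_poly_def poly_sum poly_monom poly_power sum_distrib_left
        algebra_simps)
qed

definition real_rooted :: "real poly \<Rightarrow> bool" where
  "real_rooted p \<longleftrightarrow> p = 0 \<or> (\<forall>z::complex. poly (map_poly of_real p) z = 0 \<longrightarrow> z \<in> \<real>)"

end

theory Submission
  imports Defs "HOL-Computational_Algebra.Polynomial_FPS" "HOL-Library.FuncSet"
begin

text \<open>
  Counting multichains of faces of \<open>\<partial>Q\<^sup>d\<^sub>l\<close> gives
  \<open>h(x) / (1-x)\<^sup>d = 1 + \<Sum>\<^bsub>n\<ge>1\<^esub> ((4n+1)\<^sup>l (2n+1)\<^bsup>d-l\<^esup> - (4n-1)\<^sup>l (2n-1)\<^bsup>d-l\<^esup>) x\<^sup>n\<close>.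
  Since \<open>4n+1 = 3n + (n+1)\<close> and \<open>2n+1 = n + (n+1)\<close>, and similarly for \<open>4n-1\<close>, \<open>2n-1\<close> after a
  shift of \<open>n\<close>, the polynomial \<open>(1-x) h(x)\<close> has the form \<open>W - x W'\<close>, where \<open>W\<close> and \<open>W'\<close> are
  nonnegative combinations of the polynomials
  \<open>p\<^sub>k = (1-x)\<^bsup>d+1\<^esup> \<Sum>\<^bsub>n\<ge>0\<^esub> n\<^bsup>d-k\<^esup> (n+1)\<^sup>k x\<^sup>n\<close>.
  If \<open>Im z > 0\<close>, all values \<open>p\<^sub>k(z)\<close> lie in the sector from \<open>p\<^sub>d(z)\<close> to \<open>p\<^sub>0(z) = z p\<^sub>d(z)\<close>. Hence
  \<open>W(z)\<close> and \<open>-z W'(z)\<close> lie in the same half-plane bounded by the line through \<open>z p\<^sub>d(z)\<close>, the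
  former in its interior, and \<open>h\<close> has no zeros off the real line.
\<close>

section \<open>Refined Eulerian polynomials in the upper half plane\<close>

text \<open>For \<open>k \<le> d\<close> this is the descent polynomial of the permutations of 1,
  ..., d+1 with last letter k+1. The recursion deletes the last letter; a descent is lost exactly if
  \<open>j \<ge> k\<close>.\<close>

primrec refined_eulerian :: "nat \<Rightarrow> nat \<Rightarrow> complex poly" where
  "refined_eulerian 0 k = 1"
| "refined_eulerian (Suc d) k =
     (\<Sum>j<k. refined_eulerian d j) + [:0, 1:] * (\<Sum>j=k..d. refined_eulerian d j)"

text \<open>Since (n+1) - n = 1, the series for d+1 with consecutive \<open>k\<close> differ by a
  series for d, so they telescope. The series of n^(d+1) is the shift of that of (n+1)^(d+1), which
  closes the system; multiplying by 1 - x gives the recursion.\<close>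

lemma fps_refined_eulerian:
  "k \<le> d \<Longrightarrow> fps_of_poly (refined_eulerian d k) =
     (1 - fps_X) ^ Suc d * Abs_fps (\<lambda>n. of_nat n ^ (d - k) * of_nat (Suc n) ^ k)"
proof (induction d arbitrary: k)
  case 0
  have "Abs_fps (\<lambda>n. 1 :: complex) = inverse (1 - fps_X)"
    by (simp add: fps_inverse_gp' [symmetric])
  then show ?case
    using 0 by (simp add: inverse_mult_eq_1')
next
  case (Suc d)
  define F :: "nat \<Rightarrow> nat \<Rightarrow> complex fps"
    where "F = (\<lambda>d k. Abs_fps (\<lambda>n. of_nat n ^ (d - k) * of_nat (Suc n) ^ k))"
  have step: "F (Suc d) (Suc k) = F (Suc d) k + F d k" if "k \<le> d" for k
    using that by (simp add: F_def fps_eq_iff Suc_diff_le algebra_simps)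
  have partial: "F (Suc d) k = F (Suc d) 0 + (\<Sum>j<k. F d j)" if "k \<le> Suc d" for k
    using that by (induction k) (simp_all add: step algebra_simps)
  have shift: "F (Suc d) 0 = fps_X * F (Suc d) (Suc d)"
  proof (rule fps_ext)
    fix n show "fps_nth (F (Suc d) 0) n = fps_nth (fps_X * F (Suc d) (Suc d)) n"
      by (cases n) (simp_all add: F_def del: power_Suc)
  qed
  have "F (Suc d) (Suc d) = fps_X * F (Suc d) (Suc d) + (\<Sum>j<Suc d. F d j)"
    using partial[of "Suc d"] shift by simp
  then have total: "(1 - fps_X) * F (Suc d) (Suc d) = (\<Sum>j<Suc d. F d j)"
    by (simp add: algebra_simps)
  have split: "(\<Sum>j<Suc d. F d j) = (\<Sum>j<k. F d j) + (\<Sum>j=k..d. F d j)"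
    using Suc.prems by (subst sum.union_disjoint [symmetric]) (auto simp del: sum.lessThan_Suc intro!: sum.cong)
  have "(1 - fps_X) * F (Suc d) k
      = fps_X * ((1 - fps_X) * F (Suc d) (Suc d)) + (1 - fps_X) * (\<Sum>j<k. F d j)"
    using partial[OF Suc.prems] shift by (simp add: algebra_simps)
  also have "\<dots> = (\<Sum>j<k. F d j) + fps_X * (\<Sum>j=k..d. F d j)"
    unfolding total split by (simp add: algebra_simps)
  finally have eq: "(1 - fps_X) * F (Suc d) k = (\<Sum>j<k. F d j) + fps_X * (\<Sum>j=k..d. F d j)" .
  have IH: "fps_of_poly (refined_eulerian d j) = (1 - fps_X) ^ Suc d * F d j" if "j \<le> d" for j
    using Suc.IH[OF that] by (simp add: F_def)
  have "fps_of_poly (refined_eulerian (Suc d) k)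
      = (\<Sum>j<k. (1 - fps_X) ^ Suc d * F d j) + fps_X * (\<Sum>j=k..d. (1 - fps_X) ^ Suc d * F d j)"
    using Suc.prems
    by (simp add: fps_of_poly_add fps_of_poly_mult fps_of_poly_sum IH del: power_Suc mult_pCons_left)
  also have "\<dots> = (1 - fps_X) ^ Suc d * ((1 - fps_X) * F (Suc d) k)"
    unfolding eq sum_distrib_left [symmetric] distrib_left by (simp add: mult_ac del: power_Suc)
  finally show ?case
    by (simp add: F_def mult_ac)
qed

text \<open>
  In the upper half plane the numbers \<open>p\<^sub>0, \<dots>, p\<^sub>d\<close> have decreasing arguments, all of them
  in the sector from \<open>p\<^sub>d\<close> to \<open>z p\<^sub>d\<close>; the next lemma, with \<open>a\<close>, \<open>b\<close>, \<open>c\<close> sums of consecutive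
  blocks, shows that the recursion preserves this.
\<close>

lemma sector_step:
  fixes a b c z :: complex
  assumes z: "Im z > 0"
    and "Im (a * cnj b) \<ge> 0" "Im (a * cnj c) \<ge> 0" "Im (b * cnj c) \<ge> 0"
    and "Im (z * b * cnj a) \<ge> 0" "Im (z * c * cnj a) \<ge> 0" "Im (z * c * cnj b) \<ge> 0"
  shows "Im ((a + z * (b + c)) * cnj (a + b + z * c)) \<ge> 0"
    and "Im (z * (a + b + z * c) * cnj (a + z * (b + c))) \<ge> 0"
proof -
  have "Im ((a + z * (b + c)) * cnj (a + b + z * c))
      = Im (a * cnj b) + Im (z * b * cnj a) + Im (z * c * cnj b)
        + Im z * (cmod b)\<^sup>2 + (cmod z)\<^sup>2 * Im (b * cnj c)"
    unfolding cmod_power2 by (simp add: algebra_simps power2_eq_square)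
  then show "Im ((a + z * (b + c)) * cnj (a + b + z * c)) \<ge> 0"
    using assms by simp
  \<comment> \<open>Two cross terms combine to \<open>z * (w + cnj w)\<close>, whose imaginary part
    \<open>2 * Im z * Re w\<close> may be negative. The square absorbs it into the diagonal terms of
    \<open>a\<close> and \<open>c\<close>.\<close>
  define w where "w = z * c * cnj a"
  have "0 \<le> (cmod a - cmod z * cmod c)\<^sup>2"
    by simp
  moreover have "\<bar>Re w\<bar> \<le> cmod z * cmod c * cmod a"
    using abs_Re_le_cmod[of w] by (simp add: w_def norm_mult)
  ultimately have "0 \<le> (cmod a)\<^sup>2 + (cmod z)\<^sup>2 * (cmod c)\<^sup>2 + 2 * Re w"
    by (simp add: power2_eq_square algebra_simps abs_le_iff)
  then have square: "0 \<le> Im z * ((cmod a)\<^sup>2 + (cmod z)\<^sup>2 * (cmod c)\<^sup>2 + 2 * Re w)"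
    using z by simp
  have "Im (z * (a + b + z * c) * cnj (a + z * (b + c)))
      = Im z * ((cmod a)\<^sup>2 + (cmod z)\<^sup>2 * (cmod c)\<^sup>2 + 2 * Re w)
        + (cmod z)\<^sup>2 * Im (a * cnj b) + Im (z * b * cnj a)
        + (cmod z)\<^sup>2 * Im (b * cnj c) + (cmod z)\<^sup>2 * Im (z * c * cnj b)"
    unfolding cmod_power2 w_def by (simp add: algebra_simps power2_eq_square)
  then show "Im (z * (a + b + z * c) * cnj (a + z * (b + c))) \<ge> 0"
    using assms square by simp
qed

text \<open>In the recursion for j < k, only the middle block of summands, with indices from j to
  k-1, changes from carrying the factor \<open>z\<close> to not carrying it. This is the situation
  of \<open>sector_step\<close>.\<close>

lemma refined_eulerian_sector:
  assumes z: "Im z > 0"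
  shows "j < k \<Longrightarrow> k \<le> d \<Longrightarrow>
    Im (poly (refined_eulerian d j) z * cnj (poly (refined_eulerian d k) z)) \<ge> 0 \<and>
    Im (z * poly (refined_eulerian d k) z * cnj (poly (refined_eulerian d j) z)) \<ge> 0"
proof (induction d arbitrary: j k)
  case 0
  then show ?case by simp
next
  case (Suc d)
  define p where "p = (\<lambda>j. poly (refined_eulerian d j) z)"
  have IH: "Im (p i * cnj (p k)) \<ge> 0" "Im (z * p k * cnj (p i)) \<ge> 0" if "i < k" "k \<le> d" for i k
    using Suc.IH[OF that] by (simp_all add: p_def)
  \<comment> \<open>Both expressions are additive in each argument, so the inequalities pass from
    pairs of values to sums over separated blocks.\<close>
  have block: "Im (sum p A * cnj (sum p B)) \<ge> 0" "Im (z * sum p B * cnj (sum p A)) \<ge> 0"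
    if "\<And>i k. i \<in> A \<Longrightarrow> k \<in> B \<Longrightarrow> i < k \<and> k \<le> d" for A B
  proof -
    have "Im (sum p A * cnj (sum p B)) = (\<Sum>i\<in>A. \<Sum>k\<in>B. Im (p i * cnj (p k)))"
      by (simp only: sum_product cnj_sum Im_sum)
    also have "\<dots> \<ge> 0"
      using that by (intro sum_nonneg IH) auto
    finally show "Im (sum p A * cnj (sum p B)) \<ge> 0" .
    have "Im (z * sum p B * cnj (sum p A)) = (\<Sum>k\<in>B. \<Sum>i\<in>A. Im (z * p k * cnj (p i)))"
      by (simp only: sum_distrib_left [of z] sum_product cnj_sum Im_sum)
    also have "\<dots> \<ge> 0"
      using that by (intro sum_nonneg IH) auto
    finally show "Im (z * sum p B * cnj (sum p A)) \<ge> 0" .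
  qed
  define a b c where "a = sum p {..<j}" and "b = sum p {j..<k}" and "c = sum p {k..d}"
  have "sum p {j..d} = b + c"
    unfolding b_def c_def using Suc.prems sum.atLeastLessThan_concat[of j k "Suc d" p]
    by (simp add: atLeastLessThanSuc_atLeastAtMost)
  moreover have "sum p {..<k} = a + b"
    unfolding a_def b_def using Suc.prems sum.atLeastLessThan_concat[of 0 j k p]
    by (simp add: atLeast0LessThan)
  moreover have "poly (refined_eulerian (Suc d) i) z = sum p {..<i} + z * sum p {i..d}" for i
    by (simp add: poly_sum p_def)
  ultimately have
    "poly (refined_eulerian (Suc d) j) z = a + z * (b + c)"
    "poly (refined_eulerian (Suc d) k) z = a + b + z * c"
    by (simp_all only: a_def c_def)
  moreover have "Im (a * cnj b) \<ge> 0" "Im (z * b * cnj a) \<ge> 0"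
    unfolding a_def b_def using Suc.prems by (intro block; force)+
  moreover have "Im (a * cnj c) \<ge> 0" "Im (z * c * cnj a) \<ge> 0"
    unfolding a_def c_def using Suc.prems by (intro block; force)+
  moreover have "Im (b * cnj c) \<ge> 0" "Im (z * c * cnj b) \<ge> 0"
    unfolding b_def c_def using Suc.prems by (intro block; force)+
  ultimately show ?case
    using sector_step[OF z, of a b c] by simp
qed

text \<open>The sector inequalities are weak and would hold if all values vanished. Strictness comes
  from \<open>p 0 = z * p d\<close>, which makes the sum of the \<open>p j\<close> lie strictly to
  one side of the line through \<open>p d\<close>.\<close>

lemma refined_eulerian_nonzero:
  assumes z: "Im z > 0"
  shows "poly (refined_eulerian d d) z \<noteq> 0"
proof (induction d)
  case 0
  show ?case by simp
next
  case (Suc d)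
  define p where "p = (\<lambda>j. poly (refined_eulerian d j) z)"
  have sum: "poly (refined_eulerian (Suc d) (Suc d)) z = (\<Sum>j<Suc d. p j)"
    by (simp add: poly_sum p_def)
  show ?case
  proof (cases d)
    \<comment> \<open>Here \<open>p 0\<close> and \<open>p d\<close> are both 1, so the relation
      \<open>p 0 = z * p d\<close> of the other case fails.\<close>
    case 0
    then show ?thesis by simp
  next
    case (Suc e)
    have first: "p 0 = z * p d"
      unfolding p_def Suc by (simp add: poly_sum atLeast0AtMost flip: lessThan_Suc_atMost)
    \<comment> \<open>All summands are nonnegative by the sector inequalities; only the one for
      index 0 is kept.\<close>
    have "Im ((\<Sum>j<d. p j) * cnj (p d)) \<ge> Im (p 0 * cnj (p d))"
    proof -
      have "(\<Sum>j<d. Im (p j * cnj (p d))) \<ge> Im (p 0 * cnj (p d))"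
        using Suc refined_eulerian_sector[OF z, of _ d d]
        by (intro member_le_sum) (auto simp: p_def)
      then show ?thesis
        by (simp add: sum_distrib_right)
    qed
    moreover have "Im (p 0 * cnj (p d)) = Im z * (cmod (p d))\<^sup>2"
      unfolding first cmod_power2 by (simp add: algebra_simps power2_eq_square)
    moreover have "p d \<noteq> 0"
      using Suc.IH by (simp add: p_def)
    ultimately have "Im ((\<Sum>j<Suc d. p j) * cnj (p d)) > 0"
      using z by (simp add: algebra_simps) (smt (verit) mult_pos_pos zero_less_norm_iff zero_less_power)
    then show ?thesis
      unfolding sum by (metis less_irrefl mult_zero_left zero_complex.sel(2))
  qed
qed

text \<open>The number \<open>z * p d\<close> serves as a test direction: against it the first sum
  has positive imaginary part, because of its term for \<open>k = d\<close>, and the second sum,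
  with the factor \<open>- z\<close>, contributes a nonnegative one.\<close>

lemma refined_eulerian_combination_nonzero:
  fixes e e' :: "nat \<Rightarrow> real"
  assumes z: "Im z > 0" and e: "\<And>k. e k \<ge> 0" "e d > 0" and e': "\<And>k. e' k \<ge> 0"
  shows "(\<Sum>k\<le>d. of_real (e k) * poly (refined_eulerian d k) z)
       - z * (\<Sum>k\<le>d. of_real (e' k) * poly (refined_eulerian d k) z) \<noteq> 0"
proof -
  define p where "p = (\<lambda>j. poly (refined_eulerian d j) z)"
  define W W' where "W = (\<Sum>k\<le>d. of_real (e k) * p k)" and "W' = (\<Sum>k\<le>d. of_real (e' k) * p k)"
  have pd: "p d \<noteq> 0"
    using refined_eulerian_nonzero[OF z] by (simp add: p_def)
  have top: "Im (z * p d * cnj (p d)) = Im z * (cmod (p d))\<^sup>2"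
    unfolding cmod_power2 by (simp add: algebra_simps power2_eq_square)
  have "Im (p k * cnj (p d)) \<ge> 0" if "k \<le> d" for k
    using refined_eulerian_sector[OF z, of k d d] that by (cases "k = d") (auto simp: p_def)
  then have "(\<Sum>k\<le>d. e' k * Im (p k * cnj (p d))) \<ge> 0"
    using e' by (intro sum_nonneg) auto
  also have "(\<Sum>k\<le>d. e' k * Im (p k * cnj (p d))) = Im (W' * cnj (p d))"
    unfolding W'_def sum_distrib_right Im_sum
    by (intro sum.cong refl) (simp add: algebra_simps)
  finally have W': "Im (W' * cnj (p d)) \<ge> 0" .
  have nonneg: "Im (z * p d * cnj (p k)) \<ge> 0" if "k \<le> d" for k
    using refined_eulerian_sector[OF z, of k d d] that z top by (cases "k = d") (auto simp: p_def)
  have "0 < e d * Im (z * p d * cnj (p d))"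
    using e z pd top by simp
  also have "\<dots> \<le> (\<Sum>k\<le>d. e k * Im (z * p d * cnj (p k)))"
    using e nonneg by (intro member_le_sum) auto
  also have "\<dots> = Im (z * p d * cnj W)"
    unfolding W_def cnj_sum sum_distrib_left Im_sum
    by (intro sum.cong refl) (simp add: algebra_simps)
  finally have W: "0 < Im (z * p d * cnj W)" .
  have "Im (z * p d * cnj (W - z * W')) = Im (z * p d * cnj W) + (cmod z)\<^sup>2 * Im (W' * cnj (p d))"
    unfolding cmod_power2 by (simp add: algebra_simps power2_eq_square)
  with W W' have "Im (z * p d * cnj (W - z * W')) > 0"
    by (smt (verit) mult_nonneg_nonneg zero_le_power2)
  then show ?thesis
    unfolding W_def W'_def p_def by force
qed

section \<open>Products of positive linear forms\<close>

text \<open>Multiplying in one factor at a time keeps the coefficients nonnegative, and the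
  coefficient of the pure power of \<open>v\<close> is the product of the \<open>b i\<close>. With
  \<open>u\<close> = n and \<open>v\<close> = n+1 the monomials are the coefficients in
  \<open>fps_refined_eulerian\<close>.\<close>

lemma split_binary_form:
  fixes a b :: "'i \<Rightarrow> real"
  assumes "finite I" "\<And>i. i \<in> I \<Longrightarrow> a i > 0" "\<And>i. i \<in> I \<Longrightarrow> b i > 0"
  shows "\<exists>e :: nat \<Rightarrow> real. (\<forall>k. e k \<ge> 0) \<and> e (card I) > 0 \<and> (\<forall>u v :: complex.
      (\<Prod>i\<in>I. of_real (a i) * u + of_real (b i) * v) =
      (\<Sum>k\<le>card I. of_real (e k) * (u ^ (card I - k) * v ^ k)))"
  using assms
proof (induction I rule: finite_induct)
  case empty
  show ?case by (intro exI[of _ "\<lambda>_. 1"]) simp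
next
  case (insert i I)
  then obtain e :: "nat \<Rightarrow> real" where e: "\<And>k. e k \<ge> 0" "e (card I) > 0"
    "\<And>u v :: complex. (\<Prod>i\<in>I. of_real (a i) * u + of_real (b i) * v) =
         (\<Sum>k\<le>card I. of_real (e k) * (u ^ (card I - k) * v ^ k))"
    by auto
  let ?n = "card I"
  \<comment> \<open>Beyond the degree \<open>e\<close> need not vanish (in the base case it is
    constantly 1), so the first summand is cut off there.\<close>
  define f where "f = (\<lambda>k. (if k \<le> ?n then a i * e k else 0)
                        + (case k of 0 \<Rightarrow> 0 | Suc j \<Rightarrow> b i * e j))"
  have ab: "a i > 0" "b i > 0"
    using insert.prems by auto
  have "(\<Prod>i\<in>insert i I. of_real (a i) * u + of_real (b i) * v) =
      (\<Sum>k\<le>Suc ?n. of_real (f k) * (u ^ (Suc ?n - k) * v ^ k))" for u v :: complex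
  proof -
    have "(\<Sum>k\<le>Suc ?n. of_real (f k) * (u ^ (Suc ?n - k) * v ^ k))
        = (\<Sum>k\<le>Suc ?n. of_real (if k \<le> ?n then a i * e k else 0) * (u ^ (Suc ?n - k) * v ^ k))
        + (\<Sum>k\<le>Suc ?n. of_real (case k of 0 \<Rightarrow> 0 | Suc j \<Rightarrow> b i * e j) * (u ^ (Suc ?n - k) * v ^ k))"
      by (simp only: f_def of_real_add distrib_right sum.distrib)
    also have "(\<Sum>k\<le>Suc ?n. of_real (if k \<le> ?n then a i * e k else 0) * (u ^ (Suc ?n - k) * v ^ k))
        = of_real (a i) * u * (\<Sum>k\<le>?n. of_real (e k) * (u ^ (?n - k) * v ^ k))"
      by (simp add: sum_distrib_left Suc_diff_le mult_ac)
    also have "(\<Sum>k\<le>Suc ?n. of_real (case k of 0 \<Rightarrow> 0 | Suc j \<Rightarrow> b i * e j) * (u ^ (Suc ?n - k) * v ^ k))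
        = of_real (b i) * v * (\<Sum>k\<le>?n. of_real (e k) * (u ^ (?n - k) * v ^ k))"
      by (subst sum.atMost_Suc_shift) (simp add: sum_distrib_left mult_ac)
    finally show ?thesis
      using insert.hyps e(3)[of u v] by (simp add: algebra_simps)
  qed
  moreover have "f k \<ge> 0" for k
    using ab e(1) by (auto simp: f_def split: nat.split)
  moreover have "f (Suc ?n) > 0"
    using ab e(2) by (simp add: f_def)
  ultimately show ?case
    using insert.hyps by (intro exI[of _ f]) simp
qed

section \<open>Chains in cubical complexes\<close>

text \<open>For finite \<open>C\<close> this is the f-polynomial of the order complex of
  \<open>C\<close> at x/(1-x), taken as a power series so that it can be compared with multichain
  counts.\<close>

definition chain_series :: "'a set set \<Rightarrow> complex fps" where
  "chain_series C = (\<Sum>K | subset.chain C K. (fps_X * inverse (1 - fps_X)) ^ card K)"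

lemma inverse_one_minus_fps_X: "(1 - fps_X) * inverse (1 - fps_X) = (1 :: complex fps)"
  by (simp add: inverse_mult_eq_1')

text \<open>A nonempty chain consists of its largest element and a chain strictly below it.\<close>

lemma chain_series_rec:
  assumes "finite C"
  shows "chain_series C =
    1 + (\<Sum>F\<in>C. fps_X * inverse (1 - fps_X) * chain_series {G \<in> C. G \<subset> F})"
proof -
  let ?Y = "fps_X * inverse (1 - fps_X) :: complex fps"
  define below where "below = (\<lambda>F. {G \<in> C. G \<subset> F})"
  define S where "S = Sigma C (\<lambda>F. {K. subset.chain (below F) K})"
  have fin_chains: "finite {K. subset.chain D K}" if "finite D" for D :: "'a set set"
    by (rule finite_subset[of _ "Pow D"]) (use that in \<open>auto simp: subset.chain_def\<close>)
  have fin_below: "finite (below F)" for F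
    using assms by (simp add: below_def)
  have fin_chain: "finite K" if "subset.chain (below F) K" for F K
    using that fin_below[of F] by (auto simp: subset.chain_def intro: finite_subset)
  \<comment> \<open>The largest member of a chain of sets is its union, so the pair can be recovered
    from the extended chain.\<close>
  have top: "\<Union>(insert F K) = F" "F \<notin> K" if "subset.chain (below F) K" for F K
    using that by (auto simp: subset.chain_def below_def)
  have inj: "inj_on (\<lambda>(F, K). insert F K) S"
  proof (rule inj_onI)
    fix x y assume "x \<in> S" "y \<in> S"
      and eq: "(\<lambda>(F, K). insert F K) x = (\<lambda>(F, K). insert F K) y"
    then obtain F K F' K' where xy: "x = (F, K)" "y = (F', K')"
      and K: "subset.chain (below F) K" and K': "subset.chain (below F') K'"
      by (auto simp: S_def)
    from eq xy have eq: "insert F K = insert F' K'" by simp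
    then have "F = F'"
      using top(1)[OF K] top(1)[OF K'] by metis
    then show "x = y"
      using eq top(2)[OF K] top(2)[OF K'] xy by (metis insert_ident)
  qed
  have image: "(\<lambda>(F, K). insert F K) ` S = {K. subset.chain C K} - {{}}"
  proof (intro subset_antisym subsetI)
    fix L assume "L \<in> (\<lambda>(F, K). insert F K) ` S"
    then obtain F K where L: "L = insert F K" and F: "F \<in> C" and K: "subset.chain (below F) K"
      by (auto simp: S_def)
    from K F have "subset.chain C L"
      unfolding L subset_chain_def below_def by auto
    then show "L \<in> {K. subset.chain C K} - {{}}"
      using L by simp
  next
    fix L assume "L \<in> {K. subset.chain C K} - {{}}"
    then have L: "subset.chain C L" "L \<noteq> {}" by auto
    then have "finite L"
      using assms by (auto simp: subset.chain_def intro: finite_subset)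
    with L have top: "\<Union>L \<in> L"
      by (intro Union_in_chain) auto
    have "subset.chain (below (\<Union>L)) (L - {\<Union>L})"
      using L unfolding subset_chain_def below_def by auto
    moreover have "\<Union>L \<in> C"
      using L top by (auto simp: subset.chain_def)
    ultimately have "(\<Union>L, L - {\<Union>L}) \<in> S"
      by (simp add: S_def)
    moreover have "L = (\<lambda>(F, K). insert F K) (\<Union>L, L - {\<Union>L})"
      using top by auto
    ultimately show "L \<in> (\<lambda>(F, K). insert F K) ` S" by blast
  qed
  have "chain_series C = 1 + (\<Sum>K\<in>{K. subset.chain C K} - {{}}. ?Y ^ card K)"
  proof -
    have "{} \<in> {K. subset.chain C K}"
      by (simp add: subset.chain_def)
    then show ?thesis
      unfolding chain_series_def using sum.remove[OF fin_chains[OF assms], of "{}" "\<lambda>K. ?Y ^ card K"]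
      by simp
  qed
  also have "(\<Sum>K\<in>{K. subset.chain C K} - {{}}. ?Y ^ card K)
      = (\<Sum>(F, K)\<in>S. ?Y ^ card (insert F K))"
    unfolding image[symmetric] by (subst sum.reindex[OF inj]) (simp add: case_prod_beta o_def)
  also have "\<dots> = (\<Sum>(F, K)\<in>S. ?Y * ?Y ^ card K)"
    by (intro sum.cong) (auto simp: S_def fin_chain top(2))
  also have "\<dots> = (\<Sum>F\<in>C. \<Sum>K | subset.chain (below F) K. ?Y * ?Y ^ card K)"
    unfolding S_def using assms fin_chains[OF fin_below] by (subst sum.Sigma) auto
  also have "\<dots> = (\<Sum>F\<in>C. ?Y * chain_series (below F))"
    by (simp add: chain_series_def sum_distrib_left)
  finally show ?thesis
    by (simp add: below_def)
qed

text \<open>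
  The number of multichains \<open>F\<^sub>1 \<subseteq> \<dots> \<subseteq> F\<^sub>n = F\<close> of faces is \<open>(2n - 1) ^ dim F\<close> in a cubical
  complex. Their generating function in \<open>x\<close> equals the one of the chains with top \<open>F\<close> in
  \<open>x / (1 - x)\<close>, as both satisfy the same recursion.
\<close>

lemma chain_series_cubical:
  fixes r :: "'a set \<Rightarrow> nat"
  assumes fin: "finite C"
    and cubical: "\<And>F t. F \<in> C \<Longrightarrow> (\<Sum>G | G \<in> C \<and> G \<subseteq> F. t ^ r G) = (t + 2 :: complex) ^ r F"
  shows "chain_series C =
    1 + Abs_fps (\<lambda>n. if n = 0 then 0 else \<Sum>F\<in>C. (2 * of_nat n - 1) ^ r F)"
proof -
  let ?Y = "fps_X * inverse (1 - fps_X) :: complex fps"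
  define M :: "'a set \<Rightarrow> complex fps"
    where "M = (\<lambda>F. Abs_fps (\<lambda>n. if n = 0 then 0 else (2 * of_nat n - 1) ^ r F))"
  have M: "?Y * chain_series {G \<in> C. G \<subset> F} = M F" if "F \<in> C" for F
    using that
  proof (induction "card {G \<in> C. G \<subset> F}" arbitrary: F rule: less_induct)
    case less
    have "?Y * chain_series {H \<in> {G \<in> C. G \<subset> F}. H \<subset> G} = M G" if G: "G \<in> C" "G \<subset> F" for G
    proof -
      have "{H \<in> {G \<in> C. G \<subset> F}. H \<subset> G} = {H \<in> C. H \<subset> G}"
        using G by auto
      moreover have "card {H \<in> C. H \<subset> G} < card {H \<in> C. H \<subset> F}"
        using G fin by (intro psubset_card_mono) auto
      ultimately show ?thesis
        using less.hyps G(1) by simp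
    qed
    then have rec: "chain_series {G \<in> C. G \<subset> F} = 1 + (\<Sum>G | G \<in> C \<and> G \<subset> F. M G)"
      using fin by (subst chain_series_rec) auto
    have insert: "{G \<in> C. G \<subseteq> F} = insert F {G \<in> C. G \<subset> F}"
      using less.prems by auto
    \<comment> \<open>The coefficient of x^(m+1) is the hypothesis \<open>cubical\<close> at t =
      2m-1. For m = 0 every \<open>M G\<close> has coefficient 0, and the added 1 supplies the value
      1.\<close>
    have "M F = fps_X * (1 + (\<Sum>G | G \<in> C \<and> G \<subseteq> F. M G))"
    proof (rule fps_ext)
      fix n
      show "fps_nth (M F) n = fps_nth (fps_X * (1 + (\<Sum>G | G \<in> C \<and> G \<subseteq> F. M G))) n"
      proof (cases n)
        case (Suc m)
        then show ?thesis
          using cubical[OF less.prems, of "2 * of_nat m - 1"]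
          by (cases m) (simp_all add: M_def fps_sum_nth algebra_simps)
      qed (simp add: M_def)
    qed
    also have "\<dots> = fps_X * (1 + (\<Sum>G | G \<in> C \<and> G \<subset> F. M G)) + fps_X * M F"
      unfolding insert using fin by (simp add: algebra_simps)
    finally have "(1 - fps_X) * M F = fps_X * chain_series {G \<in> C. G \<subset> F}"
      by (simp add: rec algebra_simps)
    then have "inverse (1 - fps_X) * ((1 - fps_X) * M F) = ?Y * chain_series {G \<in> C. G \<subset> F}"
      by (simp add: mult_ac)
    then show ?case
      using inverse_one_minus_fps_X by (simp add: mult_ac)
  qed
  have "chain_series C = 1 + (\<Sum>F\<in>C. M F)"
    using M fin by (subst chain_series_rec) simp_all
  also have "(\<Sum>F\<in>C. M F) = Abs_fps (\<lambda>n. if n = 0 then 0 else \<Sum>F\<in>C. (2 * of_nat n - 1) ^ r F)"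
    by (simp add: M_def fps_eq_iff fps_sum_nth)
  finally show ?thesis .
qed

section \<open>The h-polynomial as a power series\<close>

lemma map_poly_of_real_mult:
  "map_poly of_real (p * q) = map_poly of_real p * (map_poly of_real q :: complex poly)"
  by (intro poly_eqI) (simp add: coeff_map_poly coeff_mult)

lemma map_poly_of_real_sum:
  "map_poly of_real (\<Sum>i\<in>A. p i) = (\<Sum>i\<in>A. map_poly of_real (p i) :: complex poly)"
  by (intro poly_eqI) (simp add: coeff_map_poly coeff_sum)

lemma map_poly_of_real_power:
  "map_poly of_real (p ^ n) = (map_poly of_real p :: complex poly) ^ n"
  by (induction n) (simp_all add: map_poly_of_real_mult)

lemma fps_of_poly_one_minus_X: "fps_of_poly [:1, -1:] = (1 - fps_X :: complex fps)"
  by (simp add: fps_of_poly_pCons)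

text \<open>This is h(x) = (1-x)^m f(x/(1-x)) once the chains are grouped by cardinality.
  Coefficients become complex because zeros are sought there.\<close>

lemma fps_h_poly_barycentric_subdivision:
  fixes C :: "'a set set"
  assumes "finite C"
  defines "K \<equiv> barycentric_subdivision C"
  shows "fps_of_poly (map_poly of_real (h_poly K)) =
    (1 - fps_X) ^ dim_plus_one K * chain_series (C - {{}})"
proof -
  let ?Y = "fps_X * inverse (1 - fps_X) :: complex fps"
  let ?m = "dim_plus_one K"
  have K: "K = {s. subset.chain (C - {{}}) s}"
    using assms by (auto simp: barycentric_subdivision_def subset.chain_def intro: finite_subset)
  have fin: "finite K"
    unfolding K by (rule finite_subset[of _ "Pow C"]) (use assms in \<open>auto simp: subset.chain_def\<close>)
  have le: "card s \<le> ?m" if "s \<in> K" for s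
    unfolding dim_plus_one_def using fin that by (intro Max_ge) auto
  have homog: "fps_X ^ i * (1 - fps_X) ^ (?m - i) = (1 - fps_X) ^ ?m * ?Y ^ i" if "i \<le> ?m" for i
  proof -
    have "(1 - fps_X) ^ ?m = (1 - fps_X) ^ (?m - i) * (1 - fps_X :: complex fps) ^ i"
      using that by (simp flip: power_add)
    then have "(1 - fps_X) ^ ?m * ?Y ^ i = (1 - fps_X) ^ (?m - i) * ((1 - fps_X) * ?Y) ^ i"
      by (simp only: power_mult_distrib mult.assoc)
    also have "(1 - fps_X) * ?Y = fps_X"
      using inverse_one_minus_fps_X by (simp add: mult.left_commute)
    finally show ?thesis by (simp add: mult.commute)
  qed
  have const: "map_poly of_real [:a, b:] = [:of_real a, of_real b :: complex:]" for a b
    by (simp add: map_poly_pCons)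
  have "map_poly of_real (h_poly K) =
      (\<Sum>i\<le>?m. smult (of_nat (num_faces K i)) ([:0, 1:] ^ i * [:1, -1:] ^ (?m - i)) :: complex poly)"
    unfolding h_poly_def map_poly_of_real_sum
    by (intro sum.cong refl)
      (simp add: map_poly_smult map_poly_of_real_mult map_poly_of_real_power const del: mult_pCons_left)
  then have "fps_of_poly (map_poly of_real (h_poly K) :: complex poly)
      = (\<Sum>i\<le>?m. of_nat (num_faces K i) * (fps_X ^ i * (1 - fps_X) ^ (?m - i)))"
    by (simp only: fps_of_poly_sum fps_of_poly_smult fps_of_poly_mult fps_of_poly_power
        fps_of_poly_fps_X fps_of_poly_one_minus_X fps_of_nat)
  also have "\<dots> = (\<Sum>i\<le>?m. \<Sum>s\<in>{s \<in> K. card s = i}. fps_X ^ card s * (1 - fps_X) ^ (?m - card s))"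
    by (simp add: num_faces_def)
  also have "\<dots> = (\<Sum>s\<in>K. fps_X ^ card s * (1 - fps_X) ^ (?m - card s))"
    using fin le by (intro sum.group) auto
  also have "\<dots> = (\<Sum>s\<in>K. (1 - fps_X) ^ ?m * ?Y ^ card s)"
    using le homog by (intro sum.cong) auto
  also have "\<dots> = (1 - fps_X) ^ ?m * chain_series (C - {{}})"
    by (simp add: chain_series_def K sum_distrib_left)
  finally show ?thesis .
qed

section \<open>The faces of the cuboid\<close>

definition cell_box :: "('n::finite \<Rightarrow> real \<times> real) \<Rightarrow> (real ^ 'n) set" where
  "cell_box c = {x. \<forall>i. fst (c i) \<le> x $ i \<and> x $ i \<le> snd (c i)}"

definition interval_cells :: "bool \<Rightarrow> (real \<times> real) set" where
  "interval_cells b =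
     (if b then {(-1, -1), (0, 0), (1, 1), (-1, 0), (0, 1)} else {(-1, -1), (1, 1), (-1, 1)})"

text \<open>
  A cell is encoded by the endpoints of its coordinate intervals; \<open>J\<close> is the set of coordinates
  in which the cube is cut at \<open>0\<close>.
\<close>

definition cuboid_cells :: "'n set \<Rightarrow> ('n \<Rightarrow> real \<times> real) set" where
  "cuboid_cells J = {c. (\<forall>i. c i \<in> interval_cells (i \<in> J)) \<and> (\<exists>i. c i \<in> {(-1, -1), (1, 1)})}"

definition cell_dim :: "('n \<Rightarrow> real \<times> real) \<Rightarrow> nat" where
  "cell_dim c = card {i. fst (c i) < snd (c i)}"

lemma interval_cells_le: "u \<in> interval_cells b \<Longrightarrow> fst u \<le> snd u"
  by (auto simp: interval_cells_def split: if_splits)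

lemma cuboid_cells_le: "c \<in> cuboid_cells J \<Longrightarrow> fst (c i) \<le> snd (c i)"
  unfolding cuboid_cells_def by (blast intro: interval_cells_le)

lemma cell_box_nonempty_iff: "cell_box c \<noteq> {} \<longleftrightarrow> (\<forall>i. fst (c i) \<le> snd (c i))"
proof
  assume "\<forall>i. fst (c i) \<le> snd (c i)"
  then have "(\<chi> i. fst (c i)) \<in> cell_box c"
    by (simp add: cell_box_def)
  then show "cell_box c \<noteq> {}" by blast
next
  assume "cell_box c \<noteq> {}"
  then obtain x where "\<forall>i. fst (c i) \<le> x $ i \<and> x $ i \<le> snd (c i)"
    by (auto simp: cell_box_def)
  then show "\<forall>i. fst (c i) \<le> snd (c i)"
    by (meson order_trans)
qed

text \<open>The lowest and the highest corner belong to the first box, so testing these two points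
  suffices.\<close>

lemma cell_box_subset_iff:
  assumes "\<And>i. fst (c i) \<le> snd (c i)"
  shows "cell_box c \<subseteq> cell_box c' \<longleftrightarrow> (\<forall>i. fst (c' i) \<le> fst (c i) \<and> snd (c i) \<le> snd (c' i))"
proof
  assume sub: "cell_box c \<subseteq> cell_box c'"
  have "(\<chi> i. fst (c i)) \<in> cell_box c" "(\<chi> i. snd (c i)) \<in> cell_box c"
    using assms by (simp_all add: cell_box_def)
  with sub have "(\<chi> i. fst (c i)) \<in> cell_box c'" "(\<chi> i. snd (c i)) \<in> cell_box c'"
    by blast+
  then show "\<forall>i. fst (c' i) \<le> fst (c i) \<and> snd (c i) \<le> snd (c' i)"
    by (simp add: cell_box_def)
next
  assume "\<forall>i. fst (c' i) \<le> fst (c i) \<and> snd (c i) \<le> snd (c' i)"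
  then show "cell_box c \<subseteq> cell_box c'"
    unfolding cell_box_def by (blast intro: order_trans)
qed

lemma inj_on_cell_box: "inj_on cell_box (cuboid_cells J)"
proof (rule inj_onI)
  fix c c' assume cells: "c \<in> cuboid_cells J" "c' \<in> cuboid_cells J"
    and eq: "cell_box c = cell_box c'"
  from eq have "cell_box c \<subseteq> cell_box c'" "cell_box c' \<subseteq> cell_box c" by auto
  then show "c = c'"
    unfolding cell_box_subset_iff[OF cuboid_cells_le[OF cells(1)]]
      cell_box_subset_iff[OF cuboid_cells_le[OF cells(2)]]
    by (metis ext order_antisym prod_eqI)
qed

section \<open>Faces of the cube\<close>

text \<open>On the cube each term of the inner product is at most \<open>\<bar>a $ i\<bar>\<close>,
  with equality iff \<open>a $ i\<close> is 0 or \<open>x $ i\<close> is its sign. The total is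
  maximal iff every term is.\<close>

lemma cube_supporting_face:
  fixes a :: "real ^ 'n::finite"
  shows "cell_box (\<lambda>_. (-1, 1)) \<inter> {x. a \<bullet> x = (\<Sum>i\<in>UNIV. \<bar>a $ i\<bar>)} =
    cell_box (\<lambda>i. if a $ i > 0 then (1, 1) else if a $ i < 0 then (-1, -1) else (-1, 1))"
    (is "?P \<inter> ?H = cell_box ?c")
    and "cell_box (\<lambda>_. (-1, 1)) \<subseteq> {x. a \<bullet> x \<le> (\<Sum>i\<in>UNIV. \<bar>a $ i\<bar>)}"
proof -
  have term_le: "a $ i * x $ i \<le> \<bar>a $ i\<bar>" if "x \<in> ?P" for x i
  proof -
    have "\<bar>a $ i * x $ i\<bar> \<le> \<bar>a $ i\<bar> * 1"
      unfolding abs_mult using that by (intro mult_left_mono) (auto simp: cell_box_def abs_le_iff neg_le_iff_le minus_le_iff)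
    then show ?thesis by simp
  qed
  then show "?P \<subseteq> {x. a \<bullet> x \<le> (\<Sum>i\<in>UNIV. \<bar>a $ i\<bar>)}"
    by (auto simp: inner_vec_def intro!: sum_mono)
  have coord: "a $ i * x $ i = \<bar>a $ i\<bar> \<longleftrightarrow> fst (?c i) \<le> x $ i \<and> x $ i \<le> snd (?c i)"
    if x: "x \<in> ?P" for x i
  proof -
    have "-1 \<le> x $ i" "x $ i \<le> 1"
      using x by (auto simp: cell_box_def)
    moreover have "a $ i * x $ i = a $ i \<longleftrightarrow> x $ i = 1" "a $ i * x $ i = - a $ i \<longleftrightarrow> x $ i = -1"
      if "a $ i \<noteq> 0"
      using that mult_cancel_left[of "a $ i" "x $ i" "-1"] by simp_all
    ultimately show ?thesis
      by (cases "a $ i > 0"; cases "a $ i < 0") auto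
  qed
  have "x \<in> ?P \<inter> ?H \<longleftrightarrow> x \<in> cell_box ?c" for x
  proof (cases "x \<in> ?P")
    case True
    have "a \<bullet> x = (\<Sum>i\<in>UNIV. \<bar>a $ i\<bar>) \<longleftrightarrow> (\<Sum>i\<in>UNIV. \<bar>a $ i\<bar> - a $ i * x $ i) = 0"
      by (auto simp: inner_vec_def sum_subtractf)
    also have "\<dots> \<longleftrightarrow> (\<forall>i. a $ i * x $ i = \<bar>a $ i\<bar>)"
      using term_le[OF True] by (subst sum_nonneg_eq_0_iff) auto
    also have "\<dots> \<longleftrightarrow> x \<in> cell_box ?c"
      using coord[OF True] by (simp add: cell_box_def)
    finally show ?thesis
      using True by simp
  next
    case False
    have "cell_box ?c \<subseteq> ?P"
      by (subst cell_box_subset_iff) auto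
    with False show ?thesis by blast
  qed
  then show "?P \<inter> ?H = cell_box ?c" by blast
qed

text \<open>Faces of a polyhedron are exposed, so each proper nonempty face is where a nonzero
  functional attains its maximum; conversely, the signs of the fixed coordinates of a cell give such
  a functional.\<close>

lemma boundary_complex_cube:
  "boundary_complex (cbox (\<chi> i. -1) (\<chi> i. 1) :: (real ^ 'n::finite) set) - {{}} =
     cell_box ` cuboid_cells {}"
proof -
  let ?P = "cell_box (\<lambda>_::'n. (-1, 1))"
  have P: "cbox (\<chi> i. -1) (\<chi> i. 1) = ?P"
    by (auto simp: cell_box_def mem_box_cart)
  let ?c = "\<lambda>(a :: real ^ 'n) i. if a $ i > 0 then (1, 1) else if a $ i < 0 then (-1, -1) else (-1 :: real, 1 :: real)"
  have cell: "?c a \<in> cuboid_cells {}" if "a \<noteq> 0" for a :: "real ^ 'n"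
    using that by (force simp: cuboid_cells_def interval_cells_def vec_eq_iff)
  have "F \<in> cell_box ` cuboid_cells {}" if F: "F face_of ?P" "F \<noteq> ?P" "F \<noteq> {}" for F
  proof -
    have "F exposed_face_of ?P"
      using F(1) exposed_face_of_polyhedron[of ?P F] by (simp flip: P add: polyhedron_interval)
    then obtain a b where sub: "?P \<subseteq> {x. a \<bullet> x \<le> b}" and Feq: "F = ?P \<inter> {x. a \<bullet> x = b}"
      by (auto simp: exposed_face_of_def)
    \<comment> \<open>A vertex maximising the functional: it bounds \<open>b\<close> from below, and
      a point of \<open>F\<close> bounds it from above.\<close>
    define v :: "real ^ 'n" where "v = (\<chi> i. if a $ i > 0 then 1 else -1)"
    have "v \<in> ?P"
      by (simp add: v_def cell_box_def)
    moreover have "a \<bullet> v = (\<Sum>i\<in>UNIV. \<bar>a $ i\<bar>)"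
      by (auto simp: inner_vec_def v_def intro!: sum.cong)
    ultimately have "(\<Sum>i\<in>UNIV. \<bar>a $ i\<bar>) \<le> b"
      using sub by force
    moreover obtain x where "x \<in> ?P" "a \<bullet> x = b"
      using F(3) Feq by blast
    then have "b \<le> (\<Sum>i\<in>UNIV. \<bar>a $ i\<bar>)"
      using cube_supporting_face(2)[of a] by blast
    ultimately have b: "b = (\<Sum>i\<in>UNIV. \<bar>a $ i\<bar>)" by simp
    have "F = cell_box (?c a)"
      unfolding Feq b by (rule cube_supporting_face)
    moreover have "a \<noteq> 0"
    proof
      assume "a = 0"
      then have "F = ?P" using Feq b by auto
      with F(2) show False by simp
    qed
    ultimately show ?thesis
      using cell by blast
  qed
  moreover have "cell_box c face_of ?P \<and> cell_box c \<noteq> ?P \<and> cell_box c \<noteq> {}"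
    if c: "c \<in> cuboid_cells {}" for c
  proof -
    define a :: "real ^ 'n"
      where "a = (\<chi> i. if c i = (1, 1) then 1 else if c i = (-1, -1) then -1 else 0)"
    have "c i = ?c a i" for i
      using c by (auto simp: cuboid_cells_def interval_cells_def a_def)
    then have "cell_box c = ?P \<inter> {x. a \<bullet> x = (\<Sum>i\<in>UNIV. \<bar>a $ i\<bar>)}"
      unfolding cube_supporting_face(1) by presburger
    moreover have "convex ?P"
      by (simp flip: P)
    ultimately have "cell_box c face_of ?P"
      using cube_supporting_face(2)[of a] by (auto intro!: face_of_Int_supporting_hyperplane_le)
    moreover have "\<not> ?P \<subseteq> cell_box c"
    proof
      assume "?P \<subseteq> cell_box c"
      then have "fst (c i) \<le> -1" "1 \<le> snd (c i)" for i
        by (simp_all add: cell_box_subset_iff)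
      moreover obtain i where "c i = (-1, -1) \<or> c i = (1, 1)"
        using c by (auto simp: cuboid_cells_def)
      ultimately have "fst (c i) \<le> -1" "1 \<le> snd (c i)" "c i = (-1, -1) \<or> c i = (1, 1)"
        by simp_all
      then show False
        by auto
    qed
    moreover have "cell_box c \<noteq> {}"
      unfolding cell_box_nonempty_iff using cuboid_cells_le[OF c] by blast
    ultimately show ?thesis by auto
  qed
  ultimately show ?thesis
    unfolding boundary_complex_def P by blast
qed

section \<open>Cutting by coordinate hyperplanes\<close>

text \<open>Clamping at 0 may put the left endpoint above the right one; this encodes an empty
  piece.\<close>

lemma cell_box_cut:
  fixes c :: "'n::finite \<Rightarrow> real \<times> real"
  shows "cell_box c \<inter> {x. axis j 1 \<bullet> x \<le> 0} = cell_box (c(j := (fst (c j), min (snd (c j)) 0)))"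
    and "cell_box c \<inter> {x. axis j 1 \<bullet> x = 0} = cell_box (c(j := (max (fst (c j)) 0, min (snd (c j)) 0)))"
    and "cell_box c \<inter> {x. axis j 1 \<bullet> x \<ge> 0} = cell_box (c(j := (max (fst (c j)) 0, snd (c j))))"
  by (auto simp: cell_box_def inner_axis' inner_axis split: if_splits)

text \<open>Only the interval in coordinate \<open>j\<close> changes: an endpoint -1 or 1 survives
  or is lost, and [-1,1] yields its two halves and 0. A coordinate fixed at -1 or 1 stays so in
  every nonempty piece, hence the result lies in the boundary.\<close>

lemma hyperplane_subdivision_cells:
  fixes J :: "'n::finite set"
  assumes C: "C - {{}} = cell_box ` cuboid_cells J" and j: "j \<notin> J"
  shows "hyperplane_subdivision (axis j 1) 0 C - {{}} = cell_box ` cuboid_cells (insert j J)"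
proof (intro subset_antisym subsetI)
  fix G assume "G \<in> hyperplane_subdivision (axis j 1) 0 C - {{}}"
  then obtain F where "F \<in> C" and G: "G \<noteq> {}"
    "G \<in> {F \<inter> {x. axis j 1 \<bullet> x \<le> 0}, F \<inter> {x. axis j 1 \<bullet> x = 0}, F \<inter> {x. axis j 1 \<bullet> x \<ge> 0}}"
    unfolding hyperplane_subdivision_def by blast
  then have "F \<in> C - {{}}" by auto
  then obtain c where c: "c \<in> cuboid_cells J" and F: "F = cell_box c"
    unfolding C by blast
  from G obtain u where u: "G = cell_box (c(j := u))"
    "u \<in> {(fst (c j), min (snd (c j)) 0), (max (fst (c j)) 0, min (snd (c j)) 0),
          (max (fst (c j)) 0, snd (c j))}"
    unfolding F cell_box_cut by blast
  have "fst u \<le> snd u"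
    using G(1) unfolding u(1) cell_box_nonempty_iff by (metis fun_upd_same)
  moreover have "c j \<in> interval_cells False"
    using c j by (metis (mono_tags, lifting) cuboid_cells_def mem_Collect_eq)
  ultimately have u': "u \<in> interval_cells True" "c j \<in> {(-1, -1), (1, 1)} \<longrightarrow> u = c j"
    using u(2) by (auto simp: interval_cells_def)
  obtain i where "c i \<in> {(-1, -1), (1, 1)}"
    using c by (auto simp: cuboid_cells_def)
  then have "(c(j := u)) i \<in> {(-1, -1), (1, 1)}"
    using u'(2) by (cases "i = j") auto
  moreover have "(c(j := u)) i \<in> interval_cells (i \<in> insert j J)" for i
    using c u'(1) by (simp add: cuboid_cells_def)
  ultimately have "c(j := u) \<in> cuboid_cells (insert j J)"
    unfolding cuboid_cells_def by blast
  then show "G \<in> cell_box ` cuboid_cells (insert j J)"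
    using u(1) by blast
next
  fix G assume "G \<in> cell_box ` cuboid_cells (insert j J)"
  then obtain c where c: "c \<in> cuboid_cells (insert j J)" and G: "G = cell_box c" by blast
  have "c j \<in> interval_cells (j \<in> insert j J)"
    using c unfolding cuboid_cells_def by blast
  then have cj: "c j \<in> interval_cells True"
    by simp
  \<comment> \<open>The interval of an uncut face from which \<open>c j\<close> arises:
    \<open>c j\<close> itself if it is -1 or 1, otherwise all of [-1,1].\<close>
  define u where "u = (if c j \<in> {(-1, -1), (1, 1)} then c j else (-1, 1))"
  define F where "F = cell_box (c(j := u))"
  obtain i where "c i \<in> {(-1, -1), (1, 1)}"
    using c by (auto simp: cuboid_cells_def)
  then have "(c(j := u)) i \<in> {(-1, -1), (1, 1)}"
    by (cases "i = j") (auto simp: u_def)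
  moreover have "(c(j := u)) i \<in> interval_cells (i \<in> J)" for i
  proof (cases "i = j")
    case True
    then show ?thesis
      using j by (simp add: u_def interval_cells_def)
  next
    case False
    moreover have "c i \<in> interval_cells (i \<in> insert j J)"
      using c unfolding cuboid_cells_def by blast
    ultimately show ?thesis by simp
  qed
  ultimately have "c(j := u) \<in> cuboid_cells J"
    unfolding cuboid_cells_def by blast
  then have F: "F \<in> C"
    using C F_def by blast
  have "c j \<in> {(fst u, min (snd u) 0), (max (fst u) 0, min (snd u) 0), (max (fst u) 0, snd u)}"
    using cj by (auto simp: u_def interval_cells_def)
  then have "G \<in> {F \<inter> {x. axis j 1 \<bullet> x \<le> 0}, F \<inter> {x. axis j 1 \<bullet> x = 0}, F \<inter> {x. axis j 1 \<bullet> x \<ge> 0}}"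
    unfolding F_def cell_box_cut G by (auto simp: fun_upd_idem_iff dest!: sym[of "c j"])
  then have "G \<in> hyperplane_subdivision (axis j 1) 0 C"
    unfolding hyperplane_subdivision_def using F by blast
  moreover have "G \<noteq> {}"
    unfolding G cell_box_nonempty_iff using cuboid_cells_le[OF c] by blast
  ultimately show "G \<in> hyperplane_subdivision (axis j 1) 0 C - {{}}" by blast
qed

lemma cuboid_boundary_cells:
  fixes ix :: "nat \<Rightarrow> 'n::finite"
  assumes "inj_on ix {1..d}" and "l \<le> d"
  shows "cuboid_boundary ix l - {{}} = cell_box ` cuboid_cells (ix ` {1..l})"
  using assms(2)
proof (induction l)
  case 0
  then show ?case by (simp add: boundary_complex_cube)
next
  case (Suc l)
  then have "ix (Suc l) \<notin> ix ` {1..l}"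
    using assms(1) by (auto dest!: inj_onD)
  then have "hyperplane_subdivision (axis (ix (Suc l)) 1) 0 (cuboid_boundary ix l) - {{}} =
      cell_box ` cuboid_cells (insert (ix (Suc l)) (ix ` {1..l}))"
    using Suc by (intro hyperplane_subdivision_cells) auto
  then show ?case
    by (simp add: atLeastAtMostSuc_conv)
qed

section \<open>Enumerating cells by dimension\<close>

text \<open>As a product over coordinates, the weight lets sums over cells factor.\<close>

lemma power_cell_dim:
  "t ^ cell_dim c = (\<Prod>i\<in>UNIV. if fst (c i) < snd (c i) then t else (1 :: complex))"
  for c :: "'n::finite \<Rightarrow> real \<times> real"
  by (simp add: cell_dim_def prod.If_cases)

lemma sum_power_cell_dim:
  fixes B :: "'n::finite \<Rightarrow> (real \<times> real) set"
  assumes "\<And>i. finite (B i)"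
  shows "finite {c. \<forall>i. c i \<in> B i}"
    and "(\<Sum>c | \<forall>i. c i \<in> B i. t ^ cell_dim c) =
      (\<Prod>i\<in>UNIV. \<Sum>u\<in>B i. if fst u < snd u then t else (1 :: complex))"
proof -
  have PiE: "{c. \<forall>i. c i \<in> B i} = PiE UNIV B"
    by (auto simp: PiE_UNIV_domain)
  show "finite {c. \<forall>i. c i \<in> B i}"
    unfolding PiE using assms by (intro finite_PiE) auto
  show "(\<Sum>c | \<forall>i. c i \<in> B i. t ^ cell_dim c) =
      (\<Prod>i\<in>UNIV. \<Sum>u\<in>B i. if fst u < snd u then t else (1 :: complex))"
    unfolding PiE power_cell_dim using assms by (subst prod_sum_PiE) auto
qed

lemma finite_interval_cells: "finite (interval_cells b)"
  by (simp add: interval_cells_def)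

text \<open>A point contains only itself; a segment contains itself and its two endpoints, whether
  or not [-1,1] is cut.\<close>

lemma sum_subinterval_cells:
  assumes "v \<in> interval_cells b"
  shows "(\<Sum>u | u \<in> interval_cells b \<and> fst v \<le> fst u \<and> snd u \<le> snd v.
      if fst u < snd u then t else (1 :: complex)) = (if fst v < snd v then t + 2 else 1)"
  using assms by (subst sum.inter_filter [OF finite_interval_cells])
    (auto simp: interval_cells_def split: if_splits)

text \<open>This supplies the hypothesis \<open>cubical\<close> of
  \<open>chain_series_cubical\<close>: each segment factor contributes \<open>t + 2\<close>.\<close>

lemma sum_cells_below:
  fixes J :: "'n::finite set"
  assumes c: "c \<in> cuboid_cells J"
  shows "(\<Sum>c' | c' \<in> cuboid_cells J \<and> cell_box c' \<subseteq> cell_box c. t ^ cell_dim c') =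
    (t + 2 :: complex) ^ cell_dim c"
proof -
  define B where "B = (\<lambda>i. {u \<in> interval_cells (i \<in> J). fst (c i) \<le> fst u \<and> snd u \<le> snd (c i)})"
  have cells: "c i \<in> interval_cells (i \<in> J)" for i
    using c by (simp add: cuboid_cells_def)
  obtain i where i: "c i \<in> {(-1, -1), (1, 1)}"
    using c by (auto simp: cuboid_cells_def)
  \<comment> \<open>A coordinate that \<open>c\<close> fixes at -1 or 1 is fixed in every smaller
    cell, so the boundary condition is automatic and the sum runs over a full product.\<close>
  have "c' i = c i" if "c' i \<in> B i" for c' :: "'n \<Rightarrow> real \<times> real"
    using that i by (auto simp: B_def interval_cells_def split: if_splits)
  then have "c' i \<in> {(-1, -1), (1, 1)}" if "c' i \<in> B i" for c' :: "'n \<Rightarrow> real \<times> real"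
    using that i by metis
  then have "c' \<in> cuboid_cells J" if "\<forall>i. c' i \<in> B i" for c'
    using that unfolding cuboid_cells_def B_def by blast
  moreover have "cell_box c' \<subseteq> cell_box c \<longleftrightarrow> (\<forall>i. c' i \<in> B i)" if "c' \<in> cuboid_cells J" for c'
    using that cell_box_subset_iff[OF cuboid_cells_le[OF that], where c' = c]
    by (auto simp: B_def cuboid_cells_def)
  ultimately have "{c'. c' \<in> cuboid_cells J \<and> cell_box c' \<subseteq> cell_box c} = {c'. \<forall>i. c' i \<in> B i}"
    by blast
  then have "(\<Sum>c' | c' \<in> cuboid_cells J \<and> cell_box c' \<subseteq> cell_box c. t ^ cell_dim c')
      = (\<Prod>i\<in>UNIV. \<Sum>u\<in>B i. if fst u < snd u then t else 1)"
    using sum_power_cell_dim(2)[of B t] by (simp add: B_def finite_interval_cells)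
  also have "\<dots> = (\<Prod>i\<in>UNIV. if fst (c i) < snd (c i) then t + 2 else 1)"
    unfolding B_def by (simp only: sum_subinterval_cells[OF cells])
  finally show ?thesis
    by (simp only: power_cell_dim)
qed

text \<open>Cells of the whole subdivided cube minus those with no coordinate fixed at -1 or 1. A
  cut coordinate has three points and two segments, an uncut one two points and one segment; the
  second product omits -1 and 1.\<close>

lemma sum_cuboid_cells:
  fixes J :: "'n::finite set"
  shows "finite (cuboid_cells J)"
    and "(\<Sum>c\<in>cuboid_cells J. t ^ cell_dim c) =
      (\<Prod>i\<in>UNIV. if i \<in> J then 3 + 2 * t else 2 + t) -
      (\<Prod>i\<in>UNIV. if i \<in> J then 1 + 2 * t else (t :: complex))"
proof -
  define B where "B = (\<lambda>i. interval_cells (i \<in> J))"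
  define B' where "B' = (\<lambda>i. interval_cells (i \<in> J) - {(-1, -1), (1, 1)})"
  have fin: "finite (B i)" "finite (B' i)" for i
    by (simp_all add: B_def B'_def finite_interval_cells)
  have cells: "cuboid_cells J = {c. \<forall>i. c i \<in> B i} - {c. \<forall>i. c i \<in> B' i}"
    unfolding cuboid_cells_def B_def B'_def by blast
  then show "finite (cuboid_cells J)"
    using sum_power_cell_dim(1)[of B] fin by simp
  have "(\<Sum>c\<in>cuboid_cells J. t ^ cell_dim c)
      = (\<Sum>c | \<forall>i. c i \<in> B i. t ^ cell_dim c) - (\<Sum>c | \<forall>i. c i \<in> B' i. t ^ cell_dim c)"
    unfolding cells using sum_power_cell_dim(1)[of B] fin
    by (intro sum_diff) (auto simp: B_def B'_def)
  also have "(\<Sum>c | \<forall>i. c i \<in> B i. t ^ cell_dim c) = (\<Prod>i\<in>UNIV. if i \<in> J then 3 + 2 * t else 2 + t)"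
    unfolding sum_power_cell_dim(2)[of B, OF fin(1)]
    by (intro prod.cong) (auto simp: B_def interval_cells_def)
  also have "(\<Sum>c | \<forall>i. c i \<in> B' i. t ^ cell_dim c) = (\<Prod>i\<in>UNIV. if i \<in> J then 1 + 2 * t else t)"
    unfolding sum_power_cell_dim(2)[of B', OF fin(2)]
    by (intro prod.cong) (auto simp: B'_def interval_cells_def insert_Diff_if)
  finally show "(\<Sum>c\<in>cuboid_cells J. t ^ cell_dim c) =
      (\<Prod>i\<in>UNIV. if i \<in> J then 3 + 2 * t else 2 + t) -
      (\<Prod>i\<in>UNIV. if i \<in> J then 1 + 2 * t else (t :: complex))" .
qed

section \<open>Real-rootedness\<close>

text \<open>At t = 2n-1 the factors of the first product are 4n+1 and 2n+1, split as 3n+(n+1) and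
  n+(n+1). Those of the second, 4n-1 and 2n-1, become m+3(m+1) and m+(m+1) for n = m+1, whence the
  factor \<open>fps_X\<close>.\<close>

lemma chain_series_cuboid:
  fixes J :: "'n::finite set"
  shows "chain_series (cell_box ` cuboid_cells J) =
    Abs_fps (\<lambda>n. \<Prod>i\<in>UNIV. (if i \<in> J then 3 else 1) * of_nat n + of_nat (Suc n)) -
    fps_X * Abs_fps (\<lambda>n. \<Prod>i\<in>UNIV. of_nat n + (if i \<in> J then 3 else 1) * of_nat (Suc n))"
proof -
  let ?C = "cell_box ` cuboid_cells J"
  \<comment> \<open>The rank must be a function of the face as a set, so dimension is read off
    through the injective encoding.\<close>
  define r :: "(real ^ 'n) set \<Rightarrow> nat"
    where "r = (\<lambda>F. cell_dim (the_inv_into (cuboid_cells J) cell_box F))"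
  have r: "r (cell_box c) = cell_dim c" if "c \<in> cuboid_cells J" for c
    using that by (simp add: r_def the_inv_into_f_f inj_on_cell_box)
  have inj: "inj_on cell_box A" if "A \<subseteq> cuboid_cells J" for A
    using inj_on_cell_box that by (rule inj_on_subset)
  have fin: "finite ?C"
    by (simp add: sum_cuboid_cells(1))
  have total: "(\<Sum>F\<in>?C. t ^ r F) = (\<Prod>i\<in>UNIV. if i \<in> J then 3 + 2 * t else 2 + t) -
      (\<Prod>i\<in>UNIV. if i \<in> J then 1 + 2 * t else t)" for t :: complex
    by (simp add: sum.reindex inj r sum_cuboid_cells(2))
  have "(\<Sum>G | G \<in> ?C \<and> G \<subseteq> F. t ^ r G) = (t + 2) ^ r F" if F: "F \<in> ?C" for F and t :: complex
  proof -
    from F obtain c where c: "c \<in> cuboid_cells J" and F: "F = cell_box c" by blast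
    let ?A = "{c'. c' \<in> cuboid_cells J \<and> cell_box c' \<subseteq> cell_box c}"
    have "{G. G \<in> ?C \<and> G \<subseteq> F} = cell_box ` ?A"
      using F by auto
    then have "(\<Sum>G | G \<in> ?C \<and> G \<subseteq> F. t ^ r G) = (\<Sum>c'\<in>?A. t ^ cell_dim c')"
      by (simp add: sum.reindex inj r)
    then show ?thesis
      using sum_cells_below[OF c, of t] F r[OF c] by simp
  qed
  from chain_series_cubical[OF fin this] have series: "chain_series ?C =
      1 + Abs_fps (\<lambda>n. if n = 0 then 0 else \<Sum>F\<in>?C. (2 * of_nat n - 1) ^ r F)" .
  show ?thesis
    unfolding series
  proof (rule fps_ext)
    fix n
    show "fps_nth (1 + Abs_fps (\<lambda>n. if n = 0 then 0 else \<Sum>F\<in>?C. (2 * of_nat n - 1) ^ r F) :: complex fps) n =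
      fps_nth (Abs_fps (\<lambda>n. \<Prod>i\<in>UNIV. (if i \<in> J then 3 else 1) * of_nat n + of_nat (Suc n)) -
        fps_X * Abs_fps (\<lambda>n. \<Prod>i\<in>UNIV. of_nat n + (if i \<in> J then 3 else 1) * of_nat (Suc n))) n"
    \<comment> \<open>At n = 0 the first product is 1, matching the leading 1 of the chain series,
      and the shifted series contributes nothing.\<close>
    proof (cases n)
      case (Suc m)
      show ?thesis
        unfolding Suc by (auto simp: total intro!: arg_cong2[of _ _ _ _ minus] prod.cong)
    qed simp
  qed
qed

theorem corollary4p8:
  fixes d l :: nat and ix :: "nat \<Rightarrow> 'n::finite"
  assumes "1 \<le> d" and "l \<le> d"
    and "bij_betw ix {1..d} (UNIV :: 'n set)"
  shows "real_rooted (h_poly (barycentric_subdivision (cuboid_boundary ix l)))"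
proof -
  define J where "J = ix ` {1..l}"
  define C where "C = cuboid_boundary ix l"
  define K where "K = barycentric_subdivision C"
  define N where "N = CARD('n)"
  define h :: "complex poly" where "h = map_poly of_real (h_poly K)"
  have "inj_on ix {1..d}"
    using assms(3) by (rule bij_betw_imp_inj_on)
  with assms(2) have cells: "C - {{}} = cell_box ` cuboid_cells J"
    unfolding C_def J_def by (intro cuboid_boundary_cells)
  have "finite (C - {{}})"
    unfolding cells by (simp add: sum_cuboid_cells(1))
  then have "finite C" by simp
  define a where "a = (\<lambda>i. if i \<in> J then 3 else 1 :: real)"
  have a_pos: "a i > 0" for i
    by (simp add: a_def)
  \<comment> \<open>These forms will be evaluated at \<open>u\<close> = n and \<open>v\<close> =
    n+1, giving the two products in \<open>chain_series_cuboid\<close>.\<close>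
  obtain e :: "nat \<Rightarrow> real" where e: "\<And>k. e k \<ge> 0" "e N > 0"
    "\<And>u v :: complex. (\<Prod>i\<in>UNIV. of_real (a i) * u + of_real 1 * v) =
       (\<Sum>k\<le>N. of_real (e k) * (u ^ (N - k) * v ^ k))"
    using split_binary_form[of UNIV a "\<lambda>_. 1", OF finite a_pos zero_less_one, folded N_def] by blast
  obtain e' :: "nat \<Rightarrow> real" where e': "\<And>k. e' k \<ge> 0"
    "\<And>u v :: complex. (\<Prod>i\<in>UNIV. of_real 1 * u + of_real (a i) * v) =
       (\<Sum>k\<le>N. of_real (e' k) * (u ^ (N - k) * v ^ k))"
    using split_binary_form[of UNIV "\<lambda>_. 1" a, OF finite zero_less_one a_pos, folded N_def] by blast
  define W W' where "W = (\<Sum>k\<le>N. smult (of_real (e k)) (refined_eulerian N k))"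
    and "W' = (\<Sum>k\<le>N. smult (of_real (e' k)) (refined_eulerian N k))"
  have fps_W: "fps_of_poly (\<Sum>k\<le>N. smult (of_real (g k)) (refined_eulerian N k)) =
      (1 - fps_X) ^ Suc N *
      Abs_fps (\<lambda>n. \<Sum>k\<le>N. of_real (g k) * (of_nat n ^ (N - k) * of_nat (Suc n) ^ k))"
    for g :: "nat \<Rightarrow> real"
  proof -
    have "Abs_fps (\<lambda>n. \<Sum>k\<le>N. of_real (g k) * (of_nat n ^ (N - k) * of_nat (Suc n) ^ k)) =
        (\<Sum>k\<le>N. fps_const (of_real (g k)) *
          Abs_fps (\<lambda>n. of_nat n ^ (N - k) * of_nat (Suc n) ^ k :: complex))"
      by (simp add: fps_eq_iff fps_sum_nth del: of_nat_Suc)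
    then show ?thesis
      by (simp add: fps_of_poly_sum fps_of_poly_smult fps_refined_eulerian sum_distrib_left
          mult.left_commute del: power_Suc of_nat_Suc)
  qed
  have ai: "of_real (a i) = (if i \<in> J then 3 else 1 :: complex)" for i
    by (simp add: a_def)
  have "(1 - fps_X) ^ Suc N * chain_series (C - {{}}) = fps_of_poly (W - [:0, 1:] * W')"
    unfolding cells chain_series_cuboid fps_of_poly_diff fps_of_poly_mult W_def W'_def fps_W
      e(3)[symmetric] e'(2)[symmetric] ai
    by (simp add: right_diff_distrib mult.left_commute del: power_Suc of_nat_Suc)
  moreover have "fps_of_poly h = (1 - fps_X) ^ dim_plus_one K * chain_series (C - {{}})"
    unfolding h_def K_def by (rule fps_h_poly_barycentric_subdivision) fact
  ultimately have "fps_of_poly ([:1, -1:] ^ Suc N * h) =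
      fps_of_poly ([:1, -1:] ^ dim_plus_one K * (W - [:0, 1:] * W'))"
    by (simp only: fps_of_poly_mult fps_of_poly_power
        fps_of_poly_one_minus_X mult.left_commute)
  \<comment> \<open>Both powers of 1 - x stay in the identity; they have no zeros off the real line,
    so the nonreal zeros of \<open>h\<close> are those of \<open>W - [:0, 1:] * W'\<close> whatever
    \<open>dim_plus_one K\<close> is.\<close>
  then have key: "[:1, -1:] ^ Suc N * h = [:1, -1:] ^ dim_plus_one K * (W - [:0, 1:] * W')"
    by (simp only: fps_of_poly_eq_iff)
  have upper: "poly h z \<noteq> 0" if z: "Im z > 0" for z
  proof
    assume "poly h z = 0"
    then have "poly ([:1, -1:] ^ dim_plus_one K * (W - [:0, 1:] * W')) z = 0"
      unfolding key[symmetric] by simp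
    moreover have "z \<noteq> 1"
      using z by auto
    ultimately have "poly W z - z * poly W' z = 0"
      by simp
    then show False
      using refined_eulerian_combination_nonzero[OF z, of e N e'] e(1,2) e'(1)
      by (simp add: W_def W'_def poly_sum)
  qed
  \<comment> \<open>The coefficients of \<open>h\<close> are real, so conjugation also excludes
    zeros in the lower half plane.\<close>
  have "z \<in> \<real>" if "poly h z = 0" for z
  proof -
    have "poly h (cnj z) = 0"
      using that poly_cnj_real[of h z] by (simp add: h_def coeff_map_poly)
    then have "\<not> Im z > 0" "\<not> Im (cnj z) > 0"
      using upper that by blast+
    then show ?thesis
      by (simp add: complex_is_Real_iff)
  qed
  then show ?thesis
    unfolding real_rooted_def h_def K_def C_def by blast
qed

end
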